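(* For any integers $N\geq 1$ and $1\leq k<l$, there exists an algorithm using only the moves $\phi_k$ and $\phi_l$ which couples the first $N$ balls. Moreover, the length of this algorithm can be taken to be less than $N+4l^2$.
   Context: An infinite configuration is a sequence $X=(X(i))_{i\in\mathbb{Z}_{\le 0}}$ of positive integers indexed by the nonpositive integers; $X(i)$ is the number of balls in bin $i$ (bin $0$ is the rightmost bin). For an integer $k\geq1$, the move of type $k$ is the map $\phi_k$ from infinite configurations to infinite configurations defined as follows. If $X(0)\geq k$, then $Y=\phi_k(X)$ is given by $Y(0)=1$ and $Y(i)=X(i+1)$ for $i<0$ (a new rightmost bin with one ball is created and bins are relabeled). If $X(0)<k$, let $i_k=\min\{j\in\mathbb{Z}_{\le0} : \sum_{i=j}^{0}X(i)<k\}$ and set $Y(i_k)=X(i_k)+1$ and $Y(i)=X(i)$ for $i\neq i_k$. (In words: one ball is added to the bin immediately to the right of the bin containing the $k$-th ball, balls counted from right to left.) For a positive integer $n$ and an infinite configuration $X$, the $n$-ball projection $\pi_n(X)$ is the sequence indexed by $\mathbb{Z}_{\le0}$ with $(\pi_n(X))_i=\min\big(X(i),\,n-\sum_{j=i+1}^{0}X(j)\big)$ if $\sum_{j=i+1}^0X(j)<n$ and $(\pi_n(X))_i=0$ otherwise (i.e. one keeps only the rightmost $n$ balls). An algorithm is a finite composition of moves $\phi_{k_1}\circ\cdots\circ\phi_{k_m}$; its length is the number $m$ of moves composed. An algorithm $\Phi$ couples the first $n$ balls if $\pi_n(\Phi(X))=\pi_n(\Phi(Y))$ for any two infinite configurations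 $X,Y$. *)

theory Defs
  imports Main
begin

text \<open>Bins are indexed by the natural numbers: \<open>X j\<close> is the number of balls in bin \<open>-j\<close>.
  So \<open>X 0\<close> is the rightmost bin, larger indices lie further to the left, and a sum over
  the bins \<open>-j, \<dots>, 0\<close> is a sum over \<open>{..j}\<close>.\<close>

type_synonym bins = "nat \<Rightarrow> nat"

definition infinite_config :: "bins \<Rightarrow> bool" where
  "infinite_config X \<longleftrightarrow> (\<forall>j. 0 < X j)"

text \<open>The minimum over nonpositive positions in the definition of \<open>i\<^sub>k\<close> is a maximum over
  reflected positions. The set below is finite for infinite configurations and contains \<open>0\<close>
  whenever \<open>X 0 < k\<close>; \<open>leftmost_bin\<close> is only used in that situation.\<close>

definition leftmost_bin :: "nat \<Rightarrow> bins \<Rightarrow> nat" where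
  "leftmost_bin k X = Max {j. (\<Sum>i\<le>j. X i) < k}"

definition move :: "nat \<Rightarrow> bins \<Rightarrow> bins" where
  "move k X =
    (if k \<le> X 0 then (\<lambda>j. if j = 0 then 1 else X (j - 1))
     else X(leftmost_bin k X := X (leftmost_bin k X) + 1))"

definition ball_projection :: "nat \<Rightarrow> bins \<Rightarrow> bins" where
  "ball_projection n X =
    (\<lambda>j. if (\<Sum>i<j. X i) < n then min (X j) (n - (\<Sum>i<j. X i)) else 0)"

text \<open>An algorithm is represented by the list of the types of its moves, so that its length is
  the number of moves composed: \<open>[k\<^sub>1, \<dots>, k\<^sub>m]\<close> with \<open>m \<ge> 1\<close> stands for
  \<open>move k\<^sub>1 \<circ> \<dots> \<circ> move k\<^sub>m\<close>, in which the last move of the list acts first.\<close>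

definition algorithm_using :: "nat set \<Rightarrow> nat list \<Rightarrow> bool" where
  "algorithm_using K ks \<longleftrightarrow> ks \<noteq> [] \<and> set ks \<subseteq> K"

definition compose_moves :: "nat list \<Rightarrow> bins \<Rightarrow> bins" where
  "compose_moves ks = foldr (\<lambda>k \<Phi>. move k \<circ> \<Phi>) ks id"

definition couples_first :: "nat \<Rightarrow> (bins \<Rightarrow> bins) \<Rightarrow> bool" where
  "couples_first n \<Phi> \<longleftrightarrow>
    (\<forall>X Y. infinite_config X \<longrightarrow> infinite_config Y \<longrightarrow>
      ball_projection n (\<Phi> X) = ball_projection n (\<Phi> Y))"

lemma infinite_config_move: "infinite_config X \<Longrightarrow> infinite_config (move k X)"
  by (auto simp: infinite_config_def move_def)

lemma finite_leftmost_bin_candidates: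
  assumes "infinite_config X"
  shows "finite {j. (\<Sum>i\<le>j. X i) < k}"
proof (rule finite_subset)
  have "j < (\<Sum>i\<le>j. X i)" for j
  proof (induction j)
    case 0
    then show ?case using assms by (simp add: infinite_config_def)
  next
    case (Suc j)
    moreover have "0 < X (Suc j)" using assms by (simp add: infinite_config_def)
    ultimately show ?case by simp
  qed
  then show "{j. (\<Sum>i\<le>j. X i) < k} \<subseteq> {..<k}"
    by (auto intro: less_trans)
qed simp

end

theory Submission imports Defs begin

text \<open>Call a configuration cyclic when its two rightmost bins hold at least \<open>l\<close> balls; its phase
  is the size of bin \<open>0\<close>, read as \<open>0\<close> once it is at least \<open>l\<close>. Repeating the move of type \<open>l\<close>
  makes every configuration cyclic, and then rotates the phase in \<open>\<int>/l\<close>. One move of type \<open>k\<close>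
  followed by \<open>l - 1\<close> moves of type \<open>l\<close> fixes the phases below \<open>k\<close> and advances the others by one,
  so its iterates collapse the phases onto \<open>{0, \<dots>, k - 1}\<close>. Rotating by \<open>-1\<close> first turns this
  into \<open>p \<mapsto> p - 1\<close> truncated at \<open>0\<close>, whose iterates bring every phase to \<open>0\<close>. Then bin \<open>0\<close> holds
  at least \<open>l\<close> balls, i.e. the first \<open>l\<close> balls are coupled, and every further move couples one
  more ball.\<close>

section \<open>Lists of moves as compositions\<close>

lemma compose_moves_append:
  "compose_moves (ks @ ks') = compose_moves ks \<circ> compose_moves ks'"
  by (induction ks) (auto simp: compose_moves_def)

lemma compose_moves_Nil [simp]: "compose_moves [] = id"
  by (simp add: compose_moves_def)

lemma compose_moves_Cons [simp]: "compose_moves (k # ks) = move k \<circ> compose_moves ks"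
  by (simp add: compose_moves_def)

lemma compose_moves_replicate: "compose_moves (replicate n k) = move k ^^ n"
  by (induction n) auto

lemma compose_moves_concat_replicate:
  "compose_moves (concat (replicate n ks)) = compose_moves ks ^^ n"
  by (induction n) (auto simp: compose_moves_append)

section \<open>Agreement on the rightmost balls\<close>

text \<open>The entries of \<open>ball_projection n\<close> are the differences of these truncated
  prefix sums, whose behaviour under a move is simpler: a shift or one extra ball.\<close>

definition agree :: "nat \<Rightarrow> bins \<Rightarrow> bins \<Rightarrow> bool" where
  "agree n X Y \<longleftrightarrow> (\<forall>i. min n (\<Sum>j<i. X j) = min n (\<Sum>j<i. Y j))"

lemma agreeD: "agree n X Y \<Longrightarrow> min n (\<Sum>j<i. X j) = min n (\<Sum>j<i. Y j)"
  by (simp add: agree_def)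

lemma agree_mono:
  assumes "agree n X Y" "m \<le> n"
  shows "agree m X Y"
  unfolding agree_def
proof
  fix i
  show "min m (\<Sum>j<i. X j) = min m (\<Sum>j<i. Y j)"
    using agreeD[OF assms(1), of i] assms(2) by linarith
qed

lemma ball_projection_eq_diff:
  "ball_projection n X j = min n (\<Sum>i<Suc j. X i) - min n (\<Sum>i<j. X i)"
  by (auto simp: ball_projection_def)

lemma agree_imp_ball_projection_eq:
  "agree n X Y \<Longrightarrow> ball_projection n X = ball_projection n Y"
  unfolding ball_projection_eq_diff fun_eq_iff agree_def by metis

lemma agree_if_first_bin_large:
  assumes "n \<le> X 0" "n \<le> Y 0"
  shows "agree n X Y"
  unfolding agree_def
proof
  fix i
  show "min n (\<Sum>j<i. X j) = min n (\<Sum>j<i. Y j)"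
    using assms by (cases i) (simp_all add: sum.lessThan_Suc_shift del: sum.lessThan_Suc)
qed

lemma sum_lessThan_move:
  "(\<Sum>j<i. move k X j) =
    (if k \<le> X 0 then (if i = 0 then 0 else Suc (\<Sum>j<i-1. X j))
     else (\<Sum>j<i. X j) + (if leftmost_bin k X < i then 1 else 0))"
proof (cases "k \<le> X 0")
  case True
  then show ?thesis
    by (cases i) (simp_all add: move_def sum.lessThan_Suc_shift del: sum.lessThan_Suc)
next
  case False
  then show ?thesis
    by (induction i) (auto simp: move_def)
qed

lemma sum_atMost_mono:
  fixes X :: bins
  shows "i \<le> j \<Longrightarrow> (\<Sum>a\<le>i. X a) \<le> (\<Sum>a\<le>j. X a)"
  by (rule sum_mono2) auto

text \<open>The threshold \<open>m \<le> n\<close> is visible in the truncated sums, so both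
  configurations receive the new ball in the same place, and it joins the \<open>n\<close> balls
  that already agree.\<close>

lemma agree_move:
  assumes "agree n X Y" "m \<le> n" "infinite_config X"
  shows "agree (Suc n) (move m X) (move m Y)"
proof -
  have lt: "(\<Sum>a\<le>j. X a) < m \<longleftrightarrow> (\<Sum>a\<le>j. Y a) < m" for j
    using agreeD[OF assms(1), of "Suc j"] assms(2) unfolding lessThan_Suc_atMost by linarith
  have bin: "leftmost_bin m X = leftmost_bin m Y"
    unfolding leftmost_bin_def lt ..
  have first: "m \<le> X 0 \<longleftrightarrow> m \<le> Y 0"
    using lt[of 0] by auto
  show ?thesis
    unfolding agree_def
  proof
    fix i
    show "min (Suc n) (\<Sum>j<i. move m X j) = min (Suc n) (\<Sum>j<i. move m Y j)"
    proof (cases "m \<le> X 0")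
      case True
      then show ?thesis
        using first agreeD[OF assms(1), of "i - 1"] by (auto simp: sum_lessThan_move)
    next
      case False
      define J where "J = leftmost_bin m X"
      have "J \<in> {j. (\<Sum>a\<le>j. X a) < m}"
        unfolding J_def leftmost_bin_def
        using False finite_leftmost_bin_candidates[OF assms(3)]
        by (intro Max_in) (auto intro: exI[of _ 0])
      then have J: "(\<Sum>a<Suc J. X a) < n"
        using assms(2) by (simp add: lessThan_Suc_atMost del: sum.lessThan_Suc)
      \<comment> \<open>Up to the receiving bin nothing is gained while the truncation level rises
        to \<open>Suc n\<close>, so the sums must be equal outright; beyond it, both sums gain
        one.\<close>
      have "(\<Sum>a<i. X a) = (\<Sum>a<i. Y a)" if "i \<le> J"
      proof -
        have "(\<Sum>a<i. X a) \<le> (\<Sum>a<Suc J. X a)"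
          using that by (intro sum_mono2) auto
        then show ?thesis
          using J agreeD[OF assms(1), of i] by linarith
      qed
      then show ?thesis
        using False first agreeD[OF assms(1), of i] bin
        by (auto simp: sum_lessThan_move J_def[symmetric] not_less)
    qed
  qed
qed

lemma infinite_config_move_funpow:
  "infinite_config X \<Longrightarrow> infinite_config ((move k ^^ t) X)"
  by (induction t) (auto simp: infinite_config_move)

lemma agree_move_funpow:
  assumes "agree n X Y" "m \<le> n" "infinite_config X"
  shows "agree (n + t) ((move m ^^ t) X) ((move m ^^ t) Y)"
proof (induction t)
  case (Suc t)
  then show ?case
    using assms agree_move[OF Suc] by (simp add: infinite_config_move_funpow)
qed (use assms in simp)

section \<open>Reaching a cyclic configuration\<close>

lemma leftmost_bin_eqI:
  assumes "(\<Sum>i\<le>j. X i) < k" "k \<le> (\<Sum>i\<le>Suc j. X i)"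
  shows "leftmost_bin k X = j"
proof -
  have "(\<Sum>a\<le>i. X a) < k \<longleftrightarrow> i \<le> j" for i
    using assms sum_atMost_mono[of i j X] sum_atMost_mono[of "Suc j" i X]
    by (cases "i \<le> j") (auto simp: not_le Suc_le_eq simp del: sum.atMost_Suc)
  then have "{i. (\<Sum>a\<le>i. X a) < k} = {..j}"
    by auto
  then show ?thesis
    unfolding leftmost_bin_def by (auto intro: Max_eqI)
qed

text \<open>A prefix sum can drop only when a new bin is created; then the old bin \<open>0\<close>,
  with at least \<open>l\<close> balls, becomes bin \<open>1\<close> and is still counted.\<close>

lemma sum_atMost_ge_move:
  assumes "l \<le> (\<Sum>i\<le>Suc j. X i)"
  shows "l \<le> (\<Sum>i\<le>Suc j. move l X i)"
proof (cases "l \<le> X 0")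
  case True
  then show ?thesis
    using sum_atMost_mono[of 0 j X]
    unfolding lessThan_Suc_atMost[symmetric] sum_lessThan_move by simp
next
  case False
  then show ?thesis
    using assms unfolding lessThan_Suc_atMost[symmetric] sum_lessThan_move by simp
qed

lemma sum_atMost_ge_move_funpow:
  "l \<le> (\<Sum>i\<le>Suc j. X i) \<Longrightarrow> l \<le> (\<Sum>i\<le>Suc j. (move l ^^ t) X i)"
  by (induction t) (auto simp: sum_atMost_ge_move simp del: sum.atMost_Suc)

text \<open>While bins \<open>0\<close> to \<open>Suc j\<close> hold fewer than \<open>l\<close>
  balls, the next bin contains the \<open>l\<close>-th ball, so each move of type \<open>l\<close>
  adds a ball to bin \<open>Suc j\<close>.\<close>

lemma sum_atMost_move_progress:
  assumes "l \<le> (\<Sum>i\<le>Suc (Suc j). X i)"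
  shows "min l t \<le> (\<Sum>i\<le>Suc j. (move l ^^ t) X i)"
proof (induction t)
  case (Suc t)
  define Y where "Y = (move l ^^ t) X"
  have IH: "min l t \<le> (\<Sum>i\<le>Suc j. Y i)"
    using Suc unfolding Y_def .
  have "min l (Suc t) \<le> (\<Sum>i\<le>Suc j. move l Y i)"
  proof (cases "l \<le> (\<Sum>i\<le>Suc j. Y i)")
    case True
    then show ?thesis
      using sum_atMost_ge_move[of l Y j] by linarith
  next
    case False
    have "l \<le> (\<Sum>i\<le>Suc (Suc j). Y i)"
      unfolding Y_def by (rule sum_atMost_ge_move_funpow[OF assms])
    with False have "leftmost_bin l Y = Suc j"
      by (intro leftmost_bin_eqI) (auto simp del: sum.atMost_Suc)
    moreover have "\<not> l \<le> Y 0"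
      using False sum_atMost_mono[of 0 "Suc j" Y] by simp
    ultimately have "(\<Sum>i\<le>Suc j. move l Y i) = Suc (\<Sum>i\<le>Suc j. Y i)"
      unfolding lessThan_Suc_atMost[symmetric] sum_lessThan_move by simp
    then show ?thesis
      using IH by linarith
  qed
  then show ?case
    by (simp add: Y_def del: sum.atMost_Suc)
qed simp

text \<open>Each block of \<open>l\<close> moves shortens by one bin the prefix known to hold
  \<open>l\<close> balls.\<close>

lemma sum_atMost_one_ge_after_moves:
  "l \<le> (\<Sum>i\<le>Suc j. X i) \<Longrightarrow> l \<le> (\<Sum>i\<le>Suc 0. (move l ^^ (l * j)) X i)"
proof (induction j arbitrary: X)
  case (Suc j)
  have "l \<le> (\<Sum>i\<le>Suc j. (move l ^^ l) X i)"
    using sum_atMost_move_progress[OF Suc.prems, of l] by simp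
  from Suc.IH[OF this] show ?case
    by (simp add: funpow_add add.commute[of l] del: sum.atMost_Suc)
qed simp

section \<open>Dynamics of the phase\<close>

text \<open>Bins are nonempty, which frees the value \<open>0\<close> to encode a full bin
  \<open>0\<close>.\<close>

definition in_phase :: "nat \<Rightarrow> nat \<Rightarrow> bins \<Rightarrow> bool" where
  "in_phase l p X \<longleftrightarrow>
    infinite_config X \<and> l \<le> X 0 + X 1 \<and> p = (if l \<le> X 0 then 0 else X 0)"

lemma in_phase_after_moves:
  assumes "infinite_config X" "2 \<le> l"
  shows "\<exists>p<l. in_phase l p ((move l ^^ (l * (l - 2))) X)"
proof -
  \<comment> \<open>The \<open>l\<close> rightmost bins hold at least one ball each;
    \<open>l - 2\<close> blocks reduce them to two bins.\<close>
  have "(\<Sum>i\<le>Suc (l - 2). 1) \<le> (\<Sum>i\<le>Suc (l - 2). X i)"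
    using assms(1) by (intro sum_mono) (simp add: infinite_config_def Suc_le_eq)
  then have "l \<le> (\<Sum>i\<le>Suc (l - 2). X i)"
    using assms(2) by (simp del: sum.atMost_Suc)
  from sum_atMost_one_ge_after_moves[OF this] show ?thesis
    using infinite_config_move_funpow[OF assms(1)] assms(2) by (auto simp: in_phase_def)
qed

lemma leftmost_bin_0:
  assumes "X 0 < k" "k \<le> X 0 + X 1"
  shows "leftmost_bin k X = 0"
  by (rule leftmost_bin_eqI) (use assms in auto)

text \<open>A full bin \<open>0\<close> gives way to a one-ball bin; a bin with \<open>p < k\<close>
  balls gains one. As \<open>Suc p \<le> k < l\<close>, the phase does not wrap.\<close>

lemma in_phase_move:
  assumes "in_phase l p X" "p < k" "k < l"
  shows "in_phase l (Suc p) (move k X)"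
proof (cases "l \<le> X 0")
  case True
  then show ?thesis
    using assms infinite_config_move[of X k] by (auto simp: in_phase_def move_def)
next
  case False
  then show ?thesis
    using assms infinite_config_move[of X k] leftmost_bin_0[of X k]
    by (auto simp: in_phase_def move_def)
qed

lemma in_phase_move_max:
  assumes "in_phase l p X" "2 \<le> l"
  shows "in_phase l (Suc p mod l) (move l X)"
proof (cases "l \<le> X 0")
  case True
  then show ?thesis
    using assms infinite_config_move[of X l] by (auto simp: in_phase_def move_def)
next
  case False
  then show ?thesis
    using assms infinite_config_move[of X l] leftmost_bin_0[of X l]
    by (auto simp: in_phase_def move_def mod_Suc)
qed

lemma in_phase_move_max_funpow:
  assumes "in_phase l p X" "2 \<le> l" "p < l"
  shows "in_phase l ((p + t) mod l) ((move l ^^ t) X)"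
proof (induction t)
  case (Suc t)
  then show ?case
    using in_phase_move_max[OF Suc assms(2)] by (simp add: mod_Suc_eq)
qed (use assms in simp)

text \<open>As long as the \<open>l\<close>-th ball is in bin \<open>2\<close>, moves of type
  \<open>l\<close> feed bin \<open>1\<close>, which delays the rotation of the phase.\<close>

lemma second_bin_fills_up:
  assumes "infinite_config X" "X 0 = 1" "l \<le> X 0 + X 1 + X 2" "2 \<le> l" "Suc (X 1 + t) \<le> l"
  shows "(move l ^^ t) X 0 = 1 \<and> (move l ^^ t) X 1 = X 1 + t \<and> (move l ^^ t) X 2 = X 2"
  using assms(5)
proof (induction t)
  case (Suc t)
  define Y where "Y = (move l ^^ t) X"
  have Y: "Y 0 = 1" "Y 1 = X 1 + t" "Y 2 = X 2"
    using Suc by (simp_all add: Y_def)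
  have "leftmost_bin l Y = 1"
    by (rule leftmost_bin_eqI) (use Y assms Suc.prems in \<open>auto simp: numeral_2_eq_2\<close>)
  then have "move l Y = Y(1 := Y 1 + 1)"
    using Y assms(4) by (simp add: move_def)
  then show ?case
    using Y by (simp flip: Y_def)
qed (use assms(2) in simp)

text \<open>For \<open>p < k\<close> the move of type \<open>k\<close> also rotates, completing a
  full turn of \<open>l\<close> steps. For \<open>p \<ge> k\<close> it puts a one-ball bin in front
  of \<open>p\<close> balls, and some of the later moves are spent on filling the second
  bin.\<close>

lemma in_phase_collapse:
  assumes "in_phase l p X" "p < l" "1 \<le> k" "k < l"
  shows "in_phase l (if p < k then p else Suc p mod l) ((move l ^^ (l - 1)) (move k X))"
proof (cases "p < k")
  case True
  have "in_phase l ((Suc p + (l - 1)) mod l) ((move l ^^ (l - 1)) (move k X))"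
    by (rule in_phase_move_max_funpow[OF in_phase_move[OF assms(1) True assms(4)]])
      (use assms True in auto)
  moreover have "(Suc p + (l - 1)) mod l = p"
    using assms by simp
  ultimately show ?thesis
    using True by simp
next
  case False
  define Y where "Y = move k X"
  \<comment> \<open>\<open>l - 1 - p\<close> moves raise the content of bins \<open>0\<close> and
    \<open>1\<close> from \<open>1 + p\<close> to \<open>l\<close>; the other \<open>p\<close> moves
    rotate from phase \<open>1\<close>.\<close>
  define Z where "Z = (move l ^^ (l - 1 - p)) Y"
  have X: "X 0 = p" "l \<le> X 0 + X 1" "infinite_config X"
    using assms False by (auto simp: in_phase_def split: if_splits)
  have Y: "Y 0 = 1" "Y 1 = p" "Y 2 = X 1" "infinite_config Y"
    using X False infinite_config_move[of X k] by (simp_all add: Y_def move_def)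
  have "Z 0 = 1 \<and> Z 1 = Y 1 + (l - 1 - p) \<and> Z 2 = Y 2"
    unfolding Z_def by (rule second_bin_fills_up) (use X Y assms in auto)
  moreover have "infinite_config Z"
    unfolding Z_def by (rule infinite_config_move_funpow[OF Y(4)])
  ultimately have "in_phase l 1 Z"
    using Y assms by (auto simp: in_phase_def)
  then have "in_phase l ((1 + p) mod l) ((move l ^^ p) Z)"
    by (rule in_phase_move_max_funpow) (use assms in auto)
  moreover have "(move l ^^ p) Z = (move l ^^ (l - 1)) Y"
    using assms unfolding Z_def by (simp flip: funpow_add o_apply[of "move l ^^ p"])
  ultimately show ?thesis
    using False by (simp add: Y_def)
qed

text \<open>A phase not below \<open>k\<close> climbs until it wraps from \<open>l - 1\<close> to
  \<open>0\<close>. For \<open>t = l\<close> the alternative \<open>t \<le> q\<close> is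
  impossible.\<close>

lemma in_phase_collapse_funpow:
  assumes "in_phase l p X" "p < l" "1 \<le> k" "k < l"
  shows "\<exists>q<l. (q < k \<or> t \<le> q) \<and> in_phase l q (((move l ^^ (l - 1) \<circ> move k) ^^ t) X)"
proof (induction t)
  case (Suc t)
  then obtain q where q: "q < l" "q < k \<or> t \<le> q"
    "in_phase l q (((move l ^^ (l - 1) \<circ> move k) ^^ t) X)"
    by blast
  define q' where "q' = (if q < k then q else Suc q mod l)"
  have "q' < l" "q' < k \<or> Suc t \<le> q'"
    using q(1,2) assms by (auto simp: q'_def mod_Suc)
  moreover have "in_phase l q' (((move l ^^ (l - 1) \<circ> move k) ^^ Suc t) X)"
    using in_phase_collapse[OF q(3,1) assms(3,4)] by (simp add: q'_def)
  ultimately show ?case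
    by blast
qed (use assms in auto)

text \<open>\<open>l - 1\<close> moves of type \<open>l\<close> rotate by \<open>-1\<close>. Phase
  \<open>0\<close> thereby becomes \<open>l - 1 \<ge> k\<close>, which the collapse sends back to
  \<open>0\<close>; the other phases land below \<open>k\<close>, where the collapse fixes
  them.\<close>

lemma in_phase_decrement:
  assumes "in_phase l p X" "p < k" "k < l"
  shows "in_phase l (p - 1) ((move l ^^ (l - 1) \<circ> move k \<circ> move l ^^ (l - 1)) X)"
proof -
  define q where "q = (if p = 0 then l - 1 else p - 1)"
  have q: "(p + (l - 1)) mod l = q" "q < l"
    using assms by (auto simp: q_def mod_if)
  have "in_phase l q ((move l ^^ (l - 1)) X)"
    using in_phase_move_max_funpow[OF assms(1), of "l - 1"] assms q by simp
  from in_phase_collapse[OF this q(2) _ assms(3)] show ?thesis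
    using assms by (auto simp: q_def split: if_splits)
qed

lemma in_phase_decrement_funpow:
  assumes "in_phase l p X" "p < k" "k < l"
  shows "in_phase l (p - t) (((move l ^^ (l - 1) \<circ> move k \<circ> move l ^^ (l - 1)) ^^ t) X)"
proof (induction t)
  case (Suc t)
  have "p - t < k"
    using assms(2) by simp
  from in_phase_decrement[OF Suc this assms(3)] show ?case
    by simp
qed (use assms in simp)

lemma in_phase_0_imp_first_bin_large: "in_phase l 0 X \<Longrightarrow> l \<le> X 0"
  unfolding in_phase_def infinite_config_def by (metis less_irrefl)

section \<open>Assembling the algorithm and counting its moves\<close>

theorem theorem1:
  fixes N k l :: nat
  assumes "1 \<le> N" and "1 \<le> k" and "k < l"
  shows "\<exists>ks. algorithm_using {k, l} ks \<and> couples_first N (compose_moves ks)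
    \<and> length ks < N + 4 * l ^ 2"
proof -
  define collapse where "collapse = replicate (l - 1) l @ [k]"
  define decrement where "decrement = collapse @ replicate (l - 1) l"
  \<comment> \<open>The last block acts first. After \<open>l\<close> collapses the phase is at most
    \<open>k - 1\<close>, so \<open>k - 1\<close> decrements suffice.\<close>
  define ws where "ws = concat (replicate (k - 1) decrement) @ concat (replicate l collapse)
    @ replicate (l * (l - 2)) l"
  have compose_collapse: "compose_moves collapse = move l ^^ (l - 1) \<circ> move k"
    by (simp add: collapse_def compose_moves_append compose_moves_replicate)
  have compose_decrement:
    "compose_moves decrement = move l ^^ (l - 1) \<circ> move k \<circ> move l ^^ (l - 1)"
    by (simp add: decrement_def compose_collapse compose_moves_append compose_moves_replicate)
  have phase: "in_phase l 0 (compose_moves ws X)" if "infinite_config X" for X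
  proof -
    define Y where "Y = (move l ^^ (l * (l - 2))) X"
    define Z where "Z = (compose_moves collapse ^^ l) Y"
    obtain p where "p < l" "in_phase l p Y"
      using in_phase_after_moves[OF \<open>infinite_config X\<close>, of l] assms by (auto simp: Y_def)
    then obtain q where "q < k" "in_phase l q Z"
      using in_phase_collapse_funpow[of l p Y k l] assms
      by (auto simp: Z_def compose_collapse)
    then have "in_phase l 0 ((compose_moves decrement ^^ (k - 1)) Z)"
      using in_phase_decrement_funpow[of l q Z k "k - 1"] assms
      by (simp add: compose_decrement)
    then show ?thesis
      by (simp add: ws_def Z_def Y_def compose_moves_append compose_moves_replicate
          compose_moves_concat_replicate)
  qed
  define ks where "ks = replicate N l @ ws"
  have "couples_first N (compose_moves ks)"
    unfolding couples_first_def
  proof (intro allI impI)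
    fix X Y assume XY: "infinite_config X" "infinite_config Y"
    have "infinite_config (compose_moves ws X)"
      using phase[OF XY(1)] by (simp add: in_phase_def)
    moreover have "agree l (compose_moves ws X) (compose_moves ws Y)"
      using XY by (intro agree_if_first_bin_large in_phase_0_imp_first_bin_large phase)
    ultimately have "agree (l + N) (compose_moves ks X) (compose_moves ks Y)"
      by (simp add: ks_def compose_moves_append compose_moves_replicate agree_move_funpow)
    then show "ball_projection N (compose_moves ks X) = ball_projection N (compose_moves ks Y)"
      by (rule agree_imp_ball_projection_eq[OF agree_mono]) simp
  qed
  moreover have "algorithm_using {k, l} ks"
    using assms by (auto simp: algorithm_using_def ks_def ws_def decrement_def collapse_def)
  moreover have "length ks < N + 4 * l ^ 2"
  proof -
    \<comment> \<open>A collapse has \<open>l\<close> moves and a decrement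
      \<open>2 * l - 1\<close>; the three summands are bounded by \<open>2 * l^2\<close> (strictly),
      \<open>l^2\<close> and \<open>l^2\<close>.\<close>
    have "length ws = (k - 1) * (2 * l - 1) + l * l + l * (l - 2)"
      using assms by (simp add: ws_def decrement_def collapse_def length_concat sum_list_replicate mult_2)
    moreover have "(k - 1) * (2 * l - 1) \<le> l * (2 * l - 1)"
      using assms by (intro mult_right_mono) auto
    moreover have "l * (2 * l - 1) < l * (2 * l)" "l * (l - 2) \<le> l * l"
      using assms by auto
    moreover have "l * (2 * l) = 2 * (l * l)"
      by simp
    ultimately have "length ws < 4 * (l * l)"
      by linarith
    then show ?thesis
      by (simp add: ks_def power2_eq_square)
  qed
  ultimately show ?thesis
    by blast
qed

end
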